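(* For each $m\ge0$ there is $c_m>0$ such that $c_m(\log_2 n)^m\le a_n(\mathscr Z_{m+1})$ for all integers $n\ge1$.
   Context: For a Banach space $X$ and $n\in\mathbb N$, the $n$-th type 2 constant $a_n(X)$ is the infimum of the constants $a$ such that for all $x_1,\dots,x_n\in X$, the average over all choices of signs of $\left\|\sum_{i=1}^n\pm x_i\right\|^2$ is at most $a^2\sum_{i=1}^n\|x_i\|^2$. Let $\mathbb S=\{z\in\mathbb C:0<\Re z<1\}$ and let $\mathscr Z=\mathscr C(\ell_\infty,\ell_1)$ be the Calderón space of the couple $(\ell_\infty,\ell_1)$ of complex sequence spaces: the analytic functions $f:\mathbb S\to\ell_\infty$ that extend to continuous bounded functions $\overline{\mathbb S}\to\ell_\infty$, with $t\mapsto f(1+it)\in\ell_1$ continuous and bounded, normed by $\|f\|_{\mathscr Z}=\sup\{\|f(it)\|_\infty,\|f(1+it)\|_1:t\in\mathbb R\}<\infty$. For $n\ge1$, $$\mathscr Z_n=\left\{\left(\tfrac{f^{(n-1)}(1/2)}{(n-1)!},\dots,f'(1/2),f(1/2)\right): f\in\mathscr Z\right\}$$ with the quotient norm (infimum of $\|f\|_{\mathscr Z}$ over representing $f$). Convention: $0^0=1$. *)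

theory Defs
  imports "HOL-Analysis.Analysis" "HOL-Library.Function_Algebras"
begin

text \<open>Since \<^typ>\<open>nat\<close> carries the discrete topology, bounded continuous functions on it are exactly the
  bounded complex sequences, and their library norm is the supremum norm.\<close>

type_synonym linf = "nat \<Rightarrow>\<^sub>C complex"

definition cscale :: "complex \<Rightarrow> linf \<Rightarrow> linf" where
  "cscale c x = Bcontfun (\<lambda>i. c * apply_bcontfun x i)"

lemma apply_cscale [simp]: "apply_bcontfun (cscale c x) i = c * apply_bcontfun x i"
proof -
  have "bounded (range (apply_bcontfun x))"
    using apply_bcontfun[of x] by (simp add: bcontfun_def)
  then have "bounded ((\<lambda>y. c * y) ` range (apply_bcontfun x))"
    by (rule bounded_linear_image) (rule bounded_linear_mult_right)
  then have "bounded (range (\<lambda>i. c * apply_bcontfun x i))"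
    by (simp add: image_image)
  then have "(\<lambda>i. c * apply_bcontfun x i) \<in> bcontfun"
    by (simp add: bcontfun_def)
  then show ?thesis
    by (simp add: cscale_def Bcontfun_inverse)
qed

definition has_cderiv :: "(complex \<Rightarrow> linf) \<Rightarrow> linf \<Rightarrow> complex \<Rightarrow> bool" where
  "has_cderiv f v z \<longleftrightarrow> (f has_derivative (\<lambda>h. cscale h v)) (at z)"

definition cderiv :: "(complex \<Rightarrow> linf) \<Rightarrow> complex \<Rightarrow> linf" where
  "cderiv f z = (THE v. has_cderiv f v z)"

lemma cderiv_eq: "cderiv f z = v" if "has_cderiv f v z"
  unfolding cderiv_def
proof (rule the_equality)
  show "has_cderiv f v z" by fact
  fix w assume "has_cderiv f w z"
  with that have "(\<lambda>h. cscale h w) = (\<lambda>h. cscale h v)"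
    unfolding has_cderiv_def by (blast intro: has_derivative_unique)
  then have "cscale 1 w = cscale 1 v" by (rule fun_cong)
  moreover have "cscale 1 u = u" for u
    by (rule bcontfun_eqI) simp
  ultimately show "w = v" by simp
qed

definition strip :: "complex set" where
  "strip = {z. 0 < Re z \<and> Re z < 1}"

definition in_l1 :: "linf \<Rightarrow> bool" where
  "in_l1 x \<longleftrightarrow> summable (\<lambda>i. norm (apply_bcontfun x i))"

definition l1_norm :: "linf \<Rightarrow> real" where
  "l1_norm x = (\<Sum>i. norm (apply_bcontfun x i))"

text \<open>A member of the Calderon space is represented by its (unique) continuous extension to the
  closed strip; values outside the closed strip are unconstrained and affect neither the norm nor
  the derivatives at interior points. For Banach space valued functions on an open set,
  analyticity is complex differentiability at every point.\<close>

definition calderon :: "(complex \<Rightarrow> linf) set" where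
  "calderon = {f.
     (\<forall>z\<in>strip. \<exists>v. has_cderiv f v z) \<and>
     continuous_on (closure strip) f \<and> bounded (f ` closure strip) \<and>
     (\<forall>t. in_l1 (f (Complex 1 t))) \<and>
     (\<forall>t. ((\<lambda>s. l1_norm (f (Complex 1 s) - f (Complex 1 t))) \<longlongrightarrow> 0) (at t)) \<and>
     bounded (range (\<lambda>t. l1_norm (f (Complex 1 t))))}"

definition calderon_norm :: "(complex \<Rightarrow> linf) \<Rightarrow> real" where
  "calderon_norm f =
     Sup (range (\<lambda>t. norm (f (Complex 0 t))) \<union> range (\<lambda>t. l1_norm (f (Complex 1 t))))"

text \<open>An \<open>n\<close>-tuple of sequences is a function on \<^typ>\<open>nat\<close> vanishing from \<open>n\<close> on; addition of tuples is
  the pointwise one. Entry \<open>k\<close> is the Taylor coefficient of order \<open>n - 1 - k\<close>, so the highest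
  order comes first.\<close>

definition jet :: "nat \<Rightarrow> (complex \<Rightarrow> linf) \<Rightarrow> (nat \<Rightarrow> linf)" where
  "jet n f = (\<lambda>k. if k < n
     then (1 / fact (n - 1 - k)) *\<^sub>R (cderiv ^^ (n - 1 - k)) f (1/2) else 0)"

definition Z_space :: "nat \<Rightarrow> (nat \<Rightarrow> linf) set" where
  "Z_space n = jet n ` calderon"

definition Z_norm :: "nat \<Rightarrow> (nat \<Rightarrow> linf) \<Rightarrow> real" where
  "Z_norm n x = Inf {calderon_norm f | f. f \<in> calderon \<and> jet n f = x}"

text \<open>The space is given by its carrier \<open>X\<close> and its norm \<open>N\<close>, because the spaces considered here
  depend on a natural number. A choice of signs is encoded by the set \<open>P\<close> of indices carrying a
  plus sign. The set of admissible \<open>a\<close> contains \<open>sqrt n\<close> whenever \<open>N\<close> is a norm, so the real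
  infimum is a genuine one.\<close>

definition type2_const :: "'a::ab_group_add set \<Rightarrow> ('a \<Rightarrow> real) \<Rightarrow> nat \<Rightarrow> real" where
  "type2_const X N n = Inf {a. 0 \<le> a \<and>
     (\<forall>x. (\<forall>i<n. x i \<in> X) \<longrightarrow>
       (\<Sum>P\<in>Pow {..<n}. (N (\<Sum>i<n. if i \<in> P then x i else - x i))\<^sup>2) / 2 ^ n
         \<le> a\<^sup>2 * (\<Sum>i<n. (N (x i))\<^sup>2))}"

end

theory Submission
  imports Defs "HOL-Complex_Analysis.Complex_Analysis"
begin

text \<open>Test the type 2 inequality on \<open>x\<^sub>i = (0, \<dots>, 0, e\<^sub>i)\<close>, which has norm at most 1 as the jet of a
  constant function. If \<open>f\<close> represents a signed sum \<open>(0, \<dots>, 0, s)\<close> with \<open>s = \<Sum> \<plusminus>e\<^sub>i\<close>, pair it with \<open>s\<close>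
  to get a scalar function \<open>F\<close> on the strip. Then \<open>n powr (z - 1) * F z\<close> is bounded by the norm of
  \<open>f\<close> on both boundary lines, hence on the strip, while at \<open>1/2\<close> its Taylor coefficient of order
  \<open>m\<close> is \<open>sqrt n * (ln n)^m / m!\<close>, because \<open>F\<close> agrees with the constant \<open>n\<close> there up to order \<open>m\<close>.
  Cauchy's inequality bounds the norm of every signed sum below by a multiple of
  \<open>sqrt n * (ln n)^m\<close>.\<close>

section \<open>Vector-valued holomorphy\<close>

lemma norm_cscale_le: "norm (cscale c v) \<le> cmod c * norm v"
  by (rule norm_bound) (simp add: norm_mult norm_bounded mult_left_mono)

lemma bounded_linear_cscale: "bounded_linear (\<lambda>h. cscale h v)"
  by (rule bounded_linear_intro[where K = "norm v"])
     (auto intro!: bcontfun_eqI simp: algebra_simps norm_cscale_le scaleR_conv_of_real)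

lemma bounded_linear_apply_bcontfun:
  "bounded_linear (\<lambda>x :: 'a::topological_space \<Rightarrow>\<^sub>C 'b::real_normed_vector. apply_bcontfun x i)"
  by (rule bounded_linear_intro[where K = 1]) (auto simp: norm_bounded)

lemma has_cderiv_coord:
  assumes "has_cderiv f v z"
  shows "((\<lambda>w. apply_bcontfun (f w) i) has_field_derivative apply_bcontfun v i) (at z)"
  using bounded_linear.has_derivative[OF bounded_linear_apply_bcontfun assms[unfolded has_cderiv_def], of i]
  by (simp add: has_field_derivative_def mult_commute_abs)

text \<open>On open sets this is an equivalent of complex differentiability into the bounded
  sequences; both implications follow below. Local boundedness in the supremum norm is what makes
  coordinatewise estimates uniform in the index, and scalar complex analysis becomes available for
  vector-valued functions.\<close>

definition coord_holomorphic :: "complex set \<Rightarrow> (complex \<Rightarrow> linf) \<Rightarrow> bool" where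
  "coord_holomorphic S f \<longleftrightarrow>
     (\<forall>i. (\<lambda>z. apply_bcontfun (f z) i) holomorphic_on S) \<and>
     (\<forall>z\<in>S. \<exists>r>0. \<exists>B. \<forall>w\<in>ball z r. norm (f w) \<le> B)"

lemma coord_holomorphicI:
  assumes "open S" and "\<And>z. z \<in> S \<Longrightarrow> \<exists>v. has_cderiv f v z"
  shows "coord_holomorphic S f"
  unfolding coord_holomorphic_def
proof (intro conjI allI ballI)
  fix i
  show "(\<lambda>z. apply_bcontfun (f z) i) holomorphic_on S"
    unfolding holomorphic_on_open[OF \<open>open S\<close>] using assms(2) has_cderiv_coord by blast
next
  fix z assume "z \<in> S"
  then obtain v where "has_cderiv f v z" using assms(2) by blast
  then have "isCont f z"
    unfolding has_cderiv_def by (rule has_derivative_continuous)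
  then obtain r where r: "r > 0" "\<And>w. dist w z < r \<Longrightarrow> dist (f w) (f z) < 1"
    unfolding continuous_at_eps_delta by (metis zero_less_one)
  have "norm (f w) \<le> norm (f z) + 1" if "w \<in> ball z r" for w
    using r(2)[of w] that norm_triangle_sub[of "f w" "f z"] by (simp add: dist_commute dist_norm)
  then show "\<exists>r>0. \<exists>B. \<forall>w\<in>ball z r. norm (f w) \<le> B"
    using r(1) by blast
qed

text \<open>Cauchy's inequality on discs of one fixed radius bounds each derivative by the local
  supremum of \<open>norm (f x)\<close>, which does not depend on the index. A single
  \<open>r\<close> serves all orders; only the constant changes.\<close>

lemma coord_holomorphic_higher_deriv_bound:
  assumes "coord_holomorphic S f" "open S" "z \<in> S"
  obtains r where "r > 0" "ball z r \<subseteq> S"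
    "\<And>k. \<exists>C. \<forall>w\<in>ball z r. \<forall>i. cmod ((deriv ^^ k) (\<lambda>x. apply_bcontfun (f x) i) w) \<le> C"
proof -
  obtain r1 B where r1: "r1 > 0" "\<And>w. w \<in> ball z r1 \<Longrightarrow> norm (f w) \<le> B"
    using assms unfolding coord_holomorphic_def by blast
  obtain r2 where r2: "r2 > 0" "ball z r2 \<subseteq> S"
    using assms(2,3) open_contains_ball by blast
  \<comment> \<open>With half the radius, every closed disc of radius \<open>r\<close> about a point
    of \<open>ball z r\<close> stays in both neighbourhoods of \<open>z\<close>.\<close>
  define r where "r = min r1 r2 / 2"
  have r: "r > 0" using r1 r2 by (simp add: r_def)
  have sub: "cball w r \<subseteq> ball z r1 \<inter> S" if "w \<in> ball z r" for w
  proof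
    fix x assume "x \<in> cball w r"
    then have "dist z x < min r1 r2"
      using that dist_triangle[of z x w] by (simp add: r_def)
    then show "x \<in> ball z r1 \<inter> S" using r2(2) by auto
  qed
  show thesis
  proof
    show "r > 0" by fact
    show "ball z r \<subseteq> S" using sub r by fastforce
    fix k
    show "\<exists>C. \<forall>w\<in>ball z r. \<forall>i. cmod ((deriv ^^ k) (\<lambda>x. apply_bcontfun (f x) i) w) \<le> C"
    proof (intro exI ballI allI)
      fix w i assume w: "w \<in> ball z r"
      have hol: "(\<lambda>x. apply_bcontfun (f x) i) holomorphic_on cball w r"
        using assms(1) sub[OF w] unfolding coord_holomorphic_def
        by (meson holomorphic_on_subset le_inf_iff)
      show "cmod ((deriv ^^ k) (\<lambda>x. apply_bcontfun (f x) i) w) \<le> fact k * B / r ^ k"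
      proof (rule Cauchy_inequality[OF _ _ r])
        show "(\<lambda>x. apply_bcontfun (f x) i) holomorphic_on ball w r"
          using hol ball_subset_cball by (rule holomorphic_on_subset)
        show "continuous_on (cball w r) (\<lambda>x. apply_bcontfun (f x) i)"
          using hol by (rule holomorphic_on_imp_continuous_on)
        fix x assume "cmod (w - x) = r"
        then have "x \<in> cball w r" by (simp add: dist_norm)
        then have "norm (f x) \<le> B" using sub[OF w] r1(2) by blast
        then show "cmod (apply_bcontfun (f x) i) \<le> B"
          using norm_bounded order_trans by blast
      qed
    qed
  qed
qed

text \<open>The second-order Taylor remainder of the coordinates is bounded uniformly in the index, so the
  coordinatewise derivatives assemble to a derivative in the supremum norm.\<close>

lemma coord_holomorphic_has_cderiv:
  assumes "coord_holomorphic S f" "open S" "z \<in> S"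
  obtains v where "has_cderiv f v z"
    "\<And>i. apply_bcontfun v i = deriv (\<lambda>w. apply_bcontfun (f w) i) z"
proof -
  let ?g = "\<lambda>i w. apply_bcontfun (f w) i"
  obtain r where r: "r > 0" "ball z r \<subseteq> S"
    "\<And>k. \<exists>C. \<forall>w\<in>ball z r. \<forall>i. cmod ((deriv ^^ k) (?g i) w) \<le> C"
    using coord_holomorphic_higher_deriv_bound[OF assms] by blast
  obtain C where C: "\<And>w i. w \<in> ball z r \<Longrightarrow> cmod ((deriv ^^ 1) (?g i) w) \<le> C"
    using r(3) by blast
  obtain D where D: "\<And>w i. w \<in> ball z r \<Longrightarrow> cmod ((deriv ^^ 2) (?g i) w) \<le> D"
    using r(3) by blast
  \<comment> \<open>The bound \<open>C\<close>, common to all indices, makes the coordinate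
    derivatives a bounded sequence, hence a candidate for the derivative.\<close>
  have "(\<lambda>i. deriv (?g i) z) \<in> bcontfun"
    using C[of z] r(1) by (intro bcontfun_normI[where b = C]) auto
  then obtain v where v: "\<And>i. apply_bcontfun v i = deriv (?g i) z"
    by (metis bcontfunE)
  have hol: "?g i holomorphic_on ball z r" for i
    using assms(1) r(2) holomorphic_on_subset unfolding coord_holomorphic_def by blast
  have taylor: "norm (f y - f z - cscale (y - z) v) \<le> D * cmod (y - z) ^ 2" if "y \<in> ball z r" for y
  proof (rule norm_bound)
    fix i
    have "cmod ((deriv ^^ 0) (?g i) y - (\<Sum>k\<le>1. (deriv ^^ k) (?g i) z * (y - z) ^ k / fact k))
          \<le> D * cmod (y - z) ^ Suc 1 / fact 1"
    proof (rule complex_Taylor[of "ball z r"])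
      fix k x assume "x \<in> ball z r" "k \<le> (1::nat)"
      then show "((deriv ^^ k) (?g i) has_field_derivative (deriv ^^ Suc k) (?g i) x)
          (at x within ball z r)"
        using has_field_derivative_higher_deriv[OF hol] has_field_derivative_at_within by blast
    next
      fix x assume "x \<in> ball z r"
      then show "cmod ((deriv ^^ Suc 1) (?g i) x) \<le> D" using D by (simp add: numeral_2_eq_2)
    qed (use r(1) that in auto)
    then show "cmod (apply_bcontfun (f y - f z - cscale (y - z) v) i) \<le> D * cmod (y - z) ^ 2"
      by (simp add: v power2_eq_square algebra_simps)
  qed
  have "has_cderiv f v z"
    unfolding has_cderiv_def
  proof (rule has_derivativeI_sandwich[OF r(1) bounded_linear_cscale])
    fix y assume "y \<noteq> z" "dist y z < r"
    then show "norm (f y - f z - cscale (y - z) v) / norm (y - z) \<le> D * cmod (y - z)"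
      using taylor[of y] by (simp add: dist_commute divide_simps power2_eq_square mult.assoc)
  next
    show "((\<lambda>y. D * cmod (y - z)) \<longlongrightarrow> 0) (at z)"
      by (auto intro!: tendsto_eq_intros)
  qed
  then show thesis using v that by blast
qed

lemma cderiv_coord:
  assumes "coord_holomorphic S f" "open S" "z \<in> S"
  shows "apply_bcontfun (cderiv f z) i = deriv (\<lambda>w. apply_bcontfun (f w) i) z"
  using coord_holomorphic_has_cderiv[OF assms] cderiv_eq by metis

text \<open>Stability under \<open>cderiv\<close> is what allows the criterion to be iterated; the
  local bound comes from the first-order Cauchy estimate.\<close>

lemma coord_holomorphic_cderiv:
  assumes "coord_holomorphic S f" "open S"
  shows "coord_holomorphic S (cderiv f)"
  unfolding coord_holomorphic_def
proof (intro conjI allI ballI)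
  fix i
  have "deriv (\<lambda>w. apply_bcontfun (f w) i) holomorphic_on S"
    using assms unfolding coord_holomorphic_def by (blast intro: holomorphic_deriv)
  then show "(\<lambda>z. apply_bcontfun (cderiv f z) i) holomorphic_on S"
    by (rule holomorphic_transform) (simp add: cderiv_coord[OF assms])
next
  fix z assume z: "z \<in> S"
  obtain r where r: "r > 0" "ball z r \<subseteq> S"
    "\<And>k. \<exists>C. \<forall>w\<in>ball z r. \<forall>i. cmod ((deriv ^^ k) (\<lambda>x. apply_bcontfun (f x) i) w) \<le> C"
    using coord_holomorphic_higher_deriv_bound[OF assms z] by blast
  obtain C where C: "\<And>w i. w \<in> ball z r \<Longrightarrow> cmod ((deriv ^^ 1) (\<lambda>x. apply_bcontfun (f x) i) w) \<le> C"
    using r(3) by blast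
  have "norm (cderiv f w) \<le> C" if "w \<in> ball z r" for w
    using C[OF that] that r(2) by (intro norm_bound) (auto simp: cderiv_coord[OF assms])
  then show "\<exists>r>0. \<exists>B. \<forall>w\<in>ball z r. norm (cderiv f w) \<le> B"
    using r(1) by blast
qed

text \<open>Reduces the iterated vector-valued derivatives in \<open>jet\<close> to scalar
  ones.\<close>

lemma funpow_cderiv_coord:
  assumes "coord_holomorphic S f" "open S" "z \<in> S"
  shows "apply_bcontfun ((cderiv ^^ k) f z) i = (deriv ^^ k) (\<lambda>w. apply_bcontfun (f w) i) z"
  using assms(3)
proof (induction k arbitrary: z)
  case 0
  show ?case by simp
next
  case (Suc k)
  have ch: "coord_holomorphic S ((cderiv ^^ k) f)" for k
    by (induction k) (auto simp: assms(1) coord_holomorphic_cderiv[OF _ assms(2)])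
  have "apply_bcontfun ((cderiv ^^ Suc k) f z) i = deriv (\<lambda>w. apply_bcontfun ((cderiv ^^ k) f w) i) z"
    using cderiv_coord[OF ch assms(2) Suc.prems] by simp
  \<comment> \<open>The induction hypothesis is an identity on all of the open set \<open>S\<close>,
    so both sides may be differentiated at \<open>z\<close>.\<close>
  also have "\<dots> = deriv ((deriv ^^ k) (\<lambda>w. apply_bcontfun (f w) i)) z"
  proof (rule complex_derivative_transform_within_open)
    show "(\<lambda>w. apply_bcontfun ((cderiv ^^ k) f w) i) holomorphic_on S"
      using ch unfolding coord_holomorphic_def by blast
    show "(deriv ^^ k) (\<lambda>w. apply_bcontfun (f w) i) holomorphic_on S"
      using assms unfolding coord_holomorphic_def by (blast intro: holomorphic_higher_deriv)
  qed (use assms Suc in auto)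
  finally show ?case by simp
qed

section \<open>The maximum principle on the strip\<close>

lemma open_strip: "open strip"
  unfolding strip_def
  by (intro open_Collect_conj open_Collect_less continuous_intros)

lemma closure_strip: "closure strip = {z. 0 \<le> Re z \<and> Re z \<le> 1}"
proof
  show "closure strip \<subseteq> {z. 0 \<le> Re z \<and> Re z \<le> 1}"
    unfolding strip_def
    by (rule closure_minimal) (auto intro!: closed_Collect_conj closed_Collect_le continuous_intros)
  show "{z. 0 \<le> Re z \<and> Re z \<le> 1} \<subseteq> closure strip"
  proof
    fix z assume z: "z \<in> {z. 0 \<le> Re z \<and> Re z \<le> 1}"
    \<comment> \<open>Approach \<open>z\<close> along the horizontal segment through it, whose
      interior lies in the strip.\<close>
    have "(\<lambda>x. Complex x (Im z)) ` closure {0<..<1} \<subseteq> closure strip"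
      by (rule image_closure_subset)
         (auto simp: strip_def Complex_eq intro!: continuous_intros closure_subset[THEN subsetD])
    moreover have "Re z \<in> closure {0<..<1}" using z by simp
    ultimately have "Complex (Re z) (Im z) \<in> closure strip" by blast
    then show "z \<in> closure strip" by simp
  qed
qed

lemma strip_boundary_Re: "z \<in> closure strip \<Longrightarrow> z \<notin> strip \<Longrightarrow> Re z = 0 \<or> Re z = 1"
  unfolding closure_strip by (auto simp: strip_def)

text \<open>A Phragmen-Lindelof argument: division by \<open>1 + e * w\<close> makes the bounded
  function decay at infinity, so the maximum modulus principle applies on a truncated strip; then
  \<open>e\<close> tends to 0.\<close>

lemma strip_maximum_principle:
  assumes cont: "continuous_on (closure strip) g" and hol: "g holomorphic_on strip"
    and bdd: "bounded (g ` closure strip)"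
    and left: "\<And>t. cmod (g (Complex 0 t)) \<le> K" and right: "\<And>t. cmod (g (Complex 1 t)) \<le> K"
    and z: "z \<in> closure strip"
  shows "cmod (g z) \<le> K"
proof (cases "z \<in> strip")
  case False
  with z have "Re z = 0 \<or> Re z = 1" by (rule strip_boundary_Re)
  then show ?thesis using left[of "Im z"] right[of "Im z"] by (metis complex_surj)
next
  case True
  have K: "K \<ge> 0" using left[of 0] norm_ge_zero order_trans by blast
  obtain B where B: "B > 0" "\<And>w. w \<in> closure strip \<Longrightarrow> cmod (g w) \<le> B"
    using bdd unfolding bounded_pos by auto
  \<comment> \<open>Using \<open>K + e\<close> instead of \<open>K\<close> keeps the denominator
    \<open>e * (K + e)\<close> below positive even when \<open>K = 0\<close>.\<close>
  have ineq: "cmod (g z) \<le> (K + e) * (1 + e * cmod z)" if e: "e > 0" for e :: real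
  proof -
    \<comment> \<open>The first entry places \<open>z\<close> inside the truncation; the second
      makes \<open>B / (e * R)\<close> at most \<open>K + e\<close>, which settles the circular part
      of the frontier.\<close>
    define R where "R = max (cmod z + 1) (B / (e * (K + e)))"
    define S where "S = strip \<inter> ball 0 R"
    have S: "open S" unfolding S_def using open_strip by blast
    have clS: "closure S \<subseteq> closure strip \<inter> cball 0 R"
      unfolding S_def
      by (rule closure_minimal) (use closure_subset ball_subset_cball in blast, auto)
    have re: "Re (1 + of_real e * w) \<ge> 1" if "w \<in> closure strip" for w
      using that e by (simp add: closure_strip)
    have mod1: "cmod (1 + of_real e * w) \<ge> 1" if "w \<in> closure strip" for w
      using re[OF that] complex_Re_le_cmod order_trans by blast
    have nz: "1 + of_real e * w \<noteq> 0" if "w \<in> closure strip" for w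
      using mod1[OF that] by auto
    have R: "R > 0" unfolding R_def by (rule less_le_trans[of _ "cmod z + 1"]) (auto intro: add_nonneg_pos)
    have "cmod (g z / (1 + of_real e * z)) \<le> K + e"
    proof (rule maximum_modulus_frontier[of "\<lambda>w. g w / (1 + of_real e * w)" S])
      show "(\<lambda>w. g w / (1 + of_real e * w)) holomorphic_on interior S"
        unfolding interior_open[OF S]
        using nz closure_subset[of strip] hol
        by (intro holomorphic_intros) (auto simp: S_def intro: holomorphic_on_subset)
      show "continuous_on (closure S) (\<lambda>w. g w / (1 + of_real e * w))"
        using nz clS by (intro continuous_intros continuous_on_subset[OF cont]) auto
      show "bounded S" unfolding S_def by auto
      show "z \<in> S" using True by (simp add: S_def R_def less_max_iff_disj)
      fix w assume "w \<in> frontier S"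
      then have w: "w \<in> closure S" "w \<notin> S"
        using S by (auto simp: frontier_def interior_open)
      then have wc: "w \<in> closure strip" "cmod w \<le> R" using clS by auto
      show "cmod (g w / (1 + of_real e * w)) \<le> K + e"
      proof (cases "w \<in> strip")
        case False
        with wc(1) have "Re w = 0 \<or> Re w = 1" by (rule strip_boundary_Re)
        then have "cmod (g w) \<le> K" using left[of "Im w"] right[of "Im w"] by (metis complex_surj)
        \<comment> \<open>On the two vertical lines the divisor has modulus at least 1, so the
          boundary bound survives the division.\<close>
        also have "K \<le> (K + e) * cmod (1 + of_real e * w)"
          using mult_mono[of K "K + e" 1 "cmod (1 + of_real e * w)"] K e mod1[OF wc(1)] by simp
        finally show ?thesis using mod1[OF wc(1)] K e
          by (simp add: norm_divide divide_simps)
      next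
        case in_strip: True
        then have wR: "cmod w = R" using w wc by (auto simp: S_def)
        \<comment> \<open>As \<open>Re w\<close> is positive, adding 1 moves \<open>e * w\<close>
          further from the origin.\<close>
        have "(e * cmod w)\<^sup>2 \<le> (cmod (1 + of_real e * w))\<^sup>2"
        proof -
          have "(e * cmod w)\<^sup>2 = (e * Re w)\<^sup>2 + (e * Im w)\<^sup>2"
            by (simp add: power_mult_distrib cmod_power2 distrib_left)
          also have "\<dots> \<le> (1 + e * Re w)\<^sup>2 + (e * Im w)\<^sup>2"
            using e in_strip by (intro add_right_mono power_mono) (auto simp: strip_def)
          finally show ?thesis by (simp add: cmod_power2)
        qed
        then have "e * cmod w \<le> cmod (1 + of_real e * w)"
          by (rule power2_le_imp_le) simp
        then have big: "e * R \<le> cmod (1 + of_real e * w)" by (simp add: wR)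
        have "B / (e * (K + e)) \<le> R" by (simp add: R_def)
        then have "B \<le> (K + e) * (e * R)"
          using e K by (simp add: divide_simps mult_ac)
        also have "\<dots> \<le> (K + e) * cmod (1 + of_real e * w)"
          using big K e by (intro mult_left_mono) auto
        finally have "cmod (g w) \<le> (K + e) * cmod (1 + of_real e * w)"
          using B(2)[OF wc(1)] by linarith
        then show ?thesis using mod1[OF wc(1)] K e
          by (simp add: norm_divide divide_simps)
      qed
    qed
    then have "cmod (g z) \<le> (K + e) * cmod (1 + of_real e * z)"
      using nz[OF z] mod1[OF z] by (simp add: norm_divide divide_simps)
    also have "\<dots> \<le> (K + e) * (1 + e * cmod z)"
      using norm_triangle_ineq[of 1 "of_real e * z"] K e
      by (intro mult_left_mono) (auto simp: norm_mult)
    finally show ?thesis .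
  qed
  \<comment> \<open>The left side of \<open>ineq\<close> does not depend on \<open>e\<close>, so the
    limit from the right at 0 gives the bound \<open>K\<close>.\<close>
  have "((\<lambda>e. (K + e) * (1 + e * cmod z)) \<longlongrightarrow> K) (at_right 0)"
    by (auto intro!: tendsto_eq_intros)
  then show ?thesis
    by (rule tendsto_lowerbound) (auto intro!: eventually_mono[OF eventually_at_right_less] ineq)
qed

section \<open>The Calderon space\<close>

lemma in_l1_0: "in_l1 0" and l1_norm_0: "l1_norm 0 = 0"
  by (simp_all add: in_l1_def l1_norm_def)

lemma l1_norm_nonneg: "in_l1 x \<Longrightarrow> 0 \<le> l1_norm x"
  unfolding l1_norm_def in_l1_def by (simp add: suminf_nonneg)

lemma in_l1_add: "in_l1 x \<Longrightarrow> in_l1 y \<Longrightarrow> in_l1 (x + y)"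
  unfolding in_l1_def
  by (rule summable_comparison_test'[OF summable_add[of "\<lambda>i. norm (apply_bcontfun x i)" "\<lambda>i. norm (apply_bcontfun y i)"]])
     (auto intro: norm_triangle_ineq)

lemma l1_norm_add: "in_l1 x \<Longrightarrow> in_l1 y \<Longrightarrow> l1_norm (x + y) \<le> l1_norm x + l1_norm y"
  using in_l1_add[of x y] unfolding l1_norm_def in_l1_def
  by (subst suminf_add) (auto intro!: suminf_le summable_add norm_triangle_ineq)

lemma in_l1_uminus: "in_l1 (- x) \<longleftrightarrow> in_l1 x"
  by (simp add: in_l1_def)

lemma l1_norm_uminus: "l1_norm (- x) = l1_norm x"
  by (simp add: l1_norm_def)

section \<open>Norm and linear structure of the Calderon space\<close>

lemma calderon_coord_holomorphic: "f \<in> calderon \<Longrightarrow> coord_holomorphic strip f"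
  unfolding calderon_def by (auto intro: coord_holomorphicI[OF open_strip])

lemma Complex_0_closure_strip: "Complex 0 t \<in> closure strip"
  by (simp add: closure_strip)

text \<open>Makes the real supremum in \<open>calderon_norm\<close> a genuine one; the left edge is
  controlled by boundedness on the closed strip.\<close>

lemma calderon_norm_bdd:
  assumes "f \<in> calderon"
  shows "bdd_above (range (\<lambda>t. norm (f (Complex 0 t))) \<union> range (\<lambda>t. l1_norm (f (Complex 1 t))))"
proof -
  have "bounded (f ` closure strip)" "bounded (range (\<lambda>t. l1_norm (f (Complex 1 t))))"
    using assms by (auto simp: calderon_def)
  then obtain B where "\<And>w. w \<in> closure strip \<Longrightarrow> norm (f w) \<le> B"
    unfolding bounded_iff by auto
  then have "bdd_above (range (\<lambda>t. norm (f (Complex 0 t))))"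
    using Complex_0_closure_strip by (auto simp: bdd_above_def)
  then show ?thesis
    using \<open>bounded (range (\<lambda>t. l1_norm (f (Complex 1 t))))\<close> bounded_imp_bdd_above by auto
qed

lemma norm_le_calderon_norm: "f \<in> calderon \<Longrightarrow> norm (f (Complex 0 t)) \<le> calderon_norm f"
  unfolding calderon_norm_def by (rule cSup_upper[OF _ calderon_norm_bdd]) auto

lemma l1_norm_le_calderon_norm: "f \<in> calderon \<Longrightarrow> l1_norm (f (Complex 1 t)) \<le> calderon_norm f"
  unfolding calderon_norm_def by (rule cSup_upper[OF _ calderon_norm_bdd]) auto

lemma calderon_norm_least:
  assumes "\<And>t. norm (f (Complex 0 t)) \<le> B" "\<And>t. l1_norm (f (Complex 1 t)) \<le> B"
  shows "calderon_norm f \<le> B"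
  unfolding calderon_norm_def by (rule cSup_least) (use assms in auto)

lemma calderon_norm_nonneg: "f \<in> calderon \<Longrightarrow> 0 \<le> calderon_norm f"
  using norm_le_calderon_norm norm_ge_zero order_trans by blast

lemma calderon_add:
  assumes f: "f \<in> calderon" and g: "g \<in> calderon"
  shows "(\<lambda>z. f z + g z) \<in> calderon"
proof -
  have l1: "in_l1 (f (Complex 1 t))" "in_l1 (g (Complex 1 t))" for t
    using f g by (auto simp: calderon_def)
  have l1': "in_l1 (f (Complex 1 s) - f (Complex 1 t))" "in_l1 (g (Complex 1 s) - g (Complex 1 t))" for s t
    using l1 in_l1_add[of _ "- _"] by (auto simp: in_l1_uminus diff_conv_add_uminus simp del: add_uminus_conv_diff)
  have l1s: "in_l1 (f (Complex 1 t) + g (Complex 1 t))" for t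
    using l1 in_l1_add by blast
  have "\<exists>v. has_cderiv (\<lambda>z. f z + g z) v z" if z: "z \<in> strip" for z
  proof -
    obtain u v where "has_cderiv f u z" "has_cderiv g v z"
      using z f g unfolding calderon_def by blast
    moreover have "cscale h (u + v) = cscale h u + cscale h v" for h
      by (rule bcontfun_eqI) (simp add: algebra_simps)
    ultimately have "has_cderiv (\<lambda>z. f z + g z) (u + v) z"
      unfolding has_cderiv_def using has_derivative_add by fastforce
    then show ?thesis by blast
  qed
  moreover have "((\<lambda>s. l1_norm ((f (Complex 1 s) + g (Complex 1 s)) - (f (Complex 1 t) + g (Complex 1 t))))
      \<longlongrightarrow> 0) (at t)" for t
  \<comment> \<open>Subadditivity squeezes the l1 distance of the sums between 0 and the sum of the
    two l1 distances; \<open>l1'\<close> supplies the summability behind both bounds.\<close>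
  proof (rule tendsto_sandwich[where f = "\<lambda>_. 0" and h = "\<lambda>s.
        l1_norm (f (Complex 1 s) - f (Complex 1 t)) + l1_norm (g (Complex 1 s) - g (Complex 1 t))"])
    have "((\<lambda>s. l1_norm (f (Complex 1 s) - f (Complex 1 t))) \<longlongrightarrow> 0) (at t)"
      "((\<lambda>s. l1_norm (g (Complex 1 s) - g (Complex 1 t))) \<longlongrightarrow> 0) (at t)"
      using f g by (auto simp: calderon_def)
    then show "((\<lambda>s. l1_norm (f (Complex 1 s) - f (Complex 1 t)) + l1_norm (g (Complex 1 s) - g (Complex 1 t)))
        \<longlongrightarrow> 0) (at t)"
      using tendsto_add by fastforce
    show "\<forall>\<^sub>F s in at t. 0 \<le> l1_norm ((f (Complex 1 s) + g (Complex 1 s)) - (f (Complex 1 t) + g (Complex 1 t)))"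
      using in_l1_add[OF l1'] by (auto simp: algebra_simps intro!: always_eventually l1_norm_nonneg)
    show "\<forall>\<^sub>F s in at t. l1_norm ((f (Complex 1 s) + g (Complex 1 s)) - (f (Complex 1 t) + g (Complex 1 t)))
      \<le> l1_norm (f (Complex 1 s) - f (Complex 1 t)) + l1_norm (g (Complex 1 s) - g (Complex 1 t))"
      using l1_norm_add[OF l1'] by (auto simp: algebra_simps intro!: always_eventually)
  qed simp
  moreover have "bounded (range (\<lambda>t. l1_norm (f (Complex 1 t) + g (Complex 1 t))))"
    unfolding bounded_iff
    using order_trans[OF l1_norm_add[OF l1]] l1_norm_nonneg[OF l1s]
      add_mono[OF l1_norm_le_calderon_norm[OF f] l1_norm_le_calderon_norm[OF g]]
    by (intro exI[of _ "calderon_norm f + calderon_norm g"]) auto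
  ultimately show ?thesis
    using f g l1s by (auto simp: calderon_def intro!: continuous_intros bounded_plus_comp)
qed

lemma calderon_norm_add:
  assumes f: "f \<in> calderon" and g: "g \<in> calderon"
  shows "calderon_norm (\<lambda>z. f z + g z) \<le> calderon_norm f + calderon_norm g"
proof (rule calderon_norm_least)
  fix t
  show "norm (f (Complex 0 t) + g (Complex 0 t)) \<le> calderon_norm f + calderon_norm g"
    by (rule norm_triangle_le) (intro add_mono norm_le_calderon_norm f g)
  have "in_l1 (f (Complex 1 t))" "in_l1 (g (Complex 1 t))"
    using f g by (auto simp: calderon_def)
  then show "l1_norm (f (Complex 1 t) + g (Complex 1 t)) \<le> calderon_norm f + calderon_norm g"
    by (rule order_trans[OF l1_norm_add]) (intro add_mono l1_norm_le_calderon_norm f g)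
qed

lemma calderon_uminus:
  assumes f: "f \<in> calderon"
  shows "(\<lambda>z. - f z) \<in> calderon"
proof -
  have "\<exists>v. has_cderiv (\<lambda>z. - f z) v z" if z: "z \<in> strip" for z
  proof -
    obtain u where "has_cderiv f u z"
      using z f unfolding calderon_def by blast
    moreover have "cscale h (- u) = - cscale h u" for h
      by (rule bcontfun_eqI) simp
    ultimately have "has_cderiv (\<lambda>z. - f z) (- u) z"
      unfolding has_cderiv_def using has_derivative_minus by fastforce
    then show ?thesis by blast
  qed
  moreover have "l1_norm (- f (Complex 1 s) + f (Complex 1 t)) = l1_norm (f (Complex 1 s) - f (Complex 1 t))" for s t
    using l1_norm_uminus[of "f (Complex 1 s) - f (Complex 1 t)"] by simp
  moreover have "bounded ((\<lambda>z. - f z) ` closure strip)"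
    using f bounded_uminus by (auto simp: calderon_def)
  ultimately show ?thesis
    using f by (auto simp: calderon_def in_l1_uminus l1_norm_uminus intro!: continuous_intros)
qed

lemma calderon_norm_uminus: "calderon_norm (\<lambda>z. - f z) = calderon_norm f"
  by (simp add: calderon_norm_def l1_norm_uminus)

text \<open>Constant functions are the representatives of the test vectors and of zero.\<close>

lemma calderon_const:
  assumes "in_l1 x"
  shows "(\<lambda>_. x) \<in> calderon"
proof -
  have "has_cderiv (\<lambda>_. x) 0 z" for z
  proof -
    have "cscale h 0 = 0" for h by (rule bcontfun_eqI) simp
    then show ?thesis by (simp add: has_cderiv_def)
  qed
  then show ?thesis
    using assms by (auto simp: calderon_def l1_norm_0 image_constant_conv)
qed

section \<open>The norm of the jet spaces\<close>

text \<open>Turns every identity between jets into one between scalar Taylor coefficients at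
  \<open>1/2\<close>, where the standard rules for higher derivatives apply.\<close>

lemma jet_coord:
  assumes "f \<in> calderon"
  shows "apply_bcontfun (jet n f k) i =
    (if k < n then (1 / fact (n - 1 - k)) * (deriv ^^ (n - 1 - k)) (\<lambda>w. apply_bcontfun (f w) i) (1/2) else 0)"
proof -
  have "(1/2 :: complex) \<in> strip" by (simp add: strip_def)
  then show ?thesis
    using funpow_cderiv_coord[OF calderon_coord_holomorphic[OF assms] open_strip, of "1/2"]
    by (simp add: jet_def scaleR_conv_of_real)
qed

lemma calderon_coord_analytic:
  assumes "f \<in> calderon"
  shows "(\<lambda>w. apply_bcontfun (f w) i) analytic_on {1/2}"
proof -
  have "(1/2 :: complex) \<in> strip" by (simp add: strip_def)
  then show ?thesis
    using calderon_coord_holomorphic[OF assms] open_strip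
    unfolding coord_holomorphic_def analytic_at by blast
qed

lemma jet_add:
  assumes "f \<in> calderon" "g \<in> calderon"
  shows "jet n (\<lambda>z. f z + g z) = jet n f + jet n g"
proof (rule ext, rule bcontfun_eqI)
  fix k i
  show "apply_bcontfun (jet n (\<lambda>z. f z + g z) k) i = apply_bcontfun ((jet n f + jet n g) k) i"
    using assms calderon_add[OF assms]
    by (simp add: jet_coord higher_deriv_add_at calderon_coord_analytic distrib_left add_divide_distrib)
qed

lemma jet_uminus:
  assumes "f \<in> calderon"
  shows "jet n (\<lambda>z. - f z) = - jet n f"
proof (rule ext, rule bcontfun_eqI)
  fix k i
  show "apply_bcontfun (jet n (\<lambda>z. - f z) k) i = apply_bcontfun ((- jet n f) k) i"
    using assms calderon_uminus[OF assms]
    by (simp add: jet_coord higher_deriv_uminus_at calderon_coord_analytic)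
qed

lemma jet_const:
  assumes "in_l1 x"
  shows "jet (Suc m) (\<lambda>_. x) = (\<lambda>k. if k = m then x else 0)"
proof (rule ext, rule bcontfun_eqI)
  fix k i
  show "apply_bcontfun (jet (Suc m) (\<lambda>_. x) k) i = apply_bcontfun (if k = m then x else 0) i"
    by (auto simp: jet_coord[OF calderon_const[OF assms]])
qed

section \<open>The quotient norm\<close>

lemma Z_norm_le: "f \<in> calderon \<Longrightarrow> Z_norm n (jet n f) \<le> calderon_norm f"
  unfolding Z_norm_def
  by (rule cInf_lower) (auto intro!: bdd_belowI[of _ 0] calderon_norm_nonneg)

lemma Z_norm_greatest:
  assumes "x \<in> Z_space n" "\<And>f. f \<in> calderon \<Longrightarrow> jet n f = x \<Longrightarrow> B \<le> calderon_norm f"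
  shows "B \<le> Z_norm n x"
  unfolding Z_norm_def using assms by (intro cInf_greatest) (auto simp: Z_space_def)

lemma Z_norm_nonneg: "x \<in> Z_space n \<Longrightarrow> 0 \<le> Z_norm n x"
  by (rule Z_norm_greatest) (auto intro: calderon_norm_nonneg)

lemma Z_norm_approx:
  assumes "x \<in> Z_space n" "e > 0"
  obtains f where "f \<in> calderon" "jet n f = x" "calderon_norm f < Z_norm n x + e"
proof (rule ccontr)
  assume "\<not> thesis"
  then have "Z_norm n x + e \<le> Z_norm n x"
    using that by (intro Z_norm_greatest[OF assms(1)]) force
  then show False using assms(2) by simp
qed

lemma Z_space_add: "x \<in> Z_space n \<Longrightarrow> y \<in> Z_space n \<Longrightarrow> x + y \<in> Z_space n"
  unfolding Z_space_def by (auto intro!: imageI calderon_add simp: jet_add[symmetric])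

lemma Z_space_uminus: "x \<in> Z_space n \<Longrightarrow> - x \<in> Z_space n"
  unfolding Z_space_def by (auto intro!: imageI calderon_uminus simp: jet_uminus[symmetric])

text \<open>Adding near-optimal representatives, each within \<open>e / 2\<close> of its infimum,
  gives a representative of the sum.\<close>

lemma Z_norm_add:
  assumes "x \<in> Z_space n" "y \<in> Z_space n"
  shows "Z_norm n (x + y) \<le> Z_norm n x + Z_norm n y"
proof (rule field_le_epsilon)
  fix e :: real assume e: "e > 0"
  obtain f where f: "f \<in> calderon" "jet n f = x" "calderon_norm f < Z_norm n x + e / 2"
    using Z_norm_approx[OF assms(1), of "e / 2"] e by auto
  obtain g where g: "g \<in> calderon" "jet n g = y" "calderon_norm g < Z_norm n y + e / 2"
    using Z_norm_approx[OF assms(2), of "e / 2"] e by auto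
  have "Z_norm n (x + y) \<le> calderon_norm (\<lambda>z. f z + g z)"
    using Z_norm_le[OF calderon_add[OF f(1) g(1)], of n] f g by (simp add: jet_add)
  also have "\<dots> \<le> calderon_norm f + calderon_norm g"
    using f g by (simp add: calderon_norm_add)
  finally show "Z_norm n (x + y) \<le> Z_norm n x + Z_norm n y + e"
    using f g by simp
qed

text \<open>Negating a representative keeps its norm. One inequality suffices for bounding signed
  sums from above.\<close>

lemma Z_norm_uminus:
  assumes "x \<in> Z_space n"
  shows "Z_norm n (- x) \<le> Z_norm n x"
proof (rule Z_norm_greatest[OF assms])
  fix f assume "f \<in> calderon" "jet n f = x"
  then show "Z_norm n (- x) \<le> calderon_norm f"
    using Z_norm_le[OF calderon_uminus, of f n] by (simp add: jet_uminus calderon_norm_uminus)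
qed

lemma jet_zero: "jet n (\<lambda>_. 0) = 0"
  by (rule ext, rule bcontfun_eqI) (simp add: jet_coord calderon_const in_l1_0)

section \<open>Signed sums and the trivial type 2 bound\<close>

lemma Z_sum:
  assumes "finite A" "\<And>i. i \<in> A \<Longrightarrow> x i \<in> Z_space n"
  shows "(\<Sum>i\<in>A. x i) \<in> Z_space n \<and> Z_norm n (\<Sum>i\<in>A. x i) \<le> (\<Sum>i\<in>A. Z_norm n (x i))"
  using assms
proof (induction A rule: finite_induct)
  case empty
  have "calderon_norm (\<lambda>_. 0) \<le> 0" by (rule calderon_norm_least) (auto simp: l1_norm_0)
  then have "Z_norm n 0 \<le> 0" using Z_norm_le[OF calderon_const[OF in_l1_0], of n] by (simp add: jet_zero)
  moreover have "0 \<in> Z_space n"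
    unfolding Z_space_def using jet_zero calderon_const[OF in_l1_0] by (metis image_eqI)
  ultimately show ?case by (simp only: sum.empty)
next
  case (insert a A)
  then have "x a \<in> Z_space n" "sum x A \<in> Z_space n" "Z_norm n (sum x A) \<le> (\<Sum>i\<in>A. Z_norm n (x i))"
    by auto
  then show ?case
    using Z_space_add[of "x a" n "sum x A"] Z_norm_add[of "x a" n "sum x A"]
    unfolding sum.insert[OF insert.hyps] by linarith
qed

lemma Z_signed_sum:
  fixes x :: "nat \<Rightarrow> nat \<Rightarrow> linf"
  assumes "\<And>i. i < n \<Longrightarrow> x i \<in> Z_space k"
  shows "(\<Sum>i<n. if i \<in> P then x i else - x i) \<in> Z_space k"
    "Z_norm k (\<Sum>i<n. if i \<in> P then x i else - x i) \<le> (\<Sum>i<n. Z_norm k (x i))"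
proof -
  let ?y = "\<lambda>i. if i \<in> P then x i else - x i"
  have *: "sum ?y {..<n} \<in> Z_space k \<and> Z_norm k (sum ?y {..<n}) \<le> (\<Sum>i<n. Z_norm k (?y i))"
    by (rule Z_sum) (auto simp: assms Z_space_uminus)
  have "(\<Sum>i<n. Z_norm k (?y i)) \<le> (\<Sum>i<n. Z_norm k (x i))"
    by (rule sum_mono) (auto simp: assms Z_norm_uminus)
  with * show "sum ?y {..<n} \<in> Z_space k" "Z_norm k (sum ?y {..<n}) \<le> (\<Sum>i<n. Z_norm k (x i))"
    by auto
qed

text \<open>The triangle inequality and Cauchy-Schwarz bound each signed sum separately, hence their
  average. This exhibits \<open>sqrt n\<close> as an admissible constant, so the infimum defining
  \<open>type2_const\<close> is over a nonempty set.\<close>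

lemma Z_type2_bound:
  fixes x :: "nat \<Rightarrow> nat \<Rightarrow> linf"
  assumes "\<And>i. i < n \<Longrightarrow> x i \<in> Z_space k"
  shows "(\<Sum>P\<in>Pow {..<n}. (Z_norm k (\<Sum>i<n. if i \<in> P then x i else - x i))\<^sup>2) / 2 ^ n
         \<le> (sqrt n)\<^sup>2 * (\<Sum>i<n. (Z_norm k (x i))\<^sup>2)"
proof -
  have "(Z_norm k (\<Sum>i<n. if i \<in> P then x i else - x i))\<^sup>2 \<le> n * (\<Sum>i<n. (Z_norm k (x i))\<^sup>2)" for P
  proof -
    have "(Z_norm k (\<Sum>i<n. if i \<in> P then x i else - x i))\<^sup>2 \<le> (\<Sum>i<n. Z_norm k (x i))\<^sup>2"
      using Z_signed_sum[OF assms] by (intro power_mono Z_norm_nonneg) auto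
    also have "\<dots> = (\<Sum>i<n. 1 * Z_norm k (x i))\<^sup>2" by simp
    also have "\<dots> \<le> (\<Sum>i<n. 1\<^sup>2) * (\<Sum>i<n. (Z_norm k (x i))\<^sup>2)"
      by (rule Cauchy_Schwarz_ineq_sum)
    finally show ?thesis by simp
  qed
  then have "(\<Sum>P\<in>Pow {..<n}. (Z_norm k (\<Sum>i<n. if i \<in> P then x i else - x i))\<^sup>2)
      \<le> of_nat (card (Pow {..<n})) * (n * (\<Sum>i<n. (Z_norm k (x i))\<^sup>2))"
    by (intro sum_bounded_above) auto
  then show ?thesis by (simp add: card_Pow divide_simps mult_ac)
qed

section \<open>The lower bound\<close>

lemma higher_deriv_sum:
  fixes z :: complex
  assumes "\<And>j. j \<in> A \<Longrightarrow> f j holomorphic_on S" "open S" "z \<in> S"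
  shows "(deriv ^^ k) (\<lambda>w. \<Sum>j\<in>A. f j w) z = (\<Sum>j\<in>A. (deriv ^^ k) (f j) z)"
  using assms(1)
proof (induction A rule: infinite_finite_induct)
  case (insert a A)
  have "(deriv ^^ k) (\<lambda>w. f a w + (\<Sum>j\<in>A. f j w)) z = (deriv ^^ k) (f a) z + (deriv ^^ k) (\<lambda>w. \<Sum>j\<in>A. f j w) z"
    using insert.prems by (intro higher_deriv_add[OF _ _ assms(2,3)] holomorphic_on_sum) auto
  then show ?case using insert by simp
qed auto

text \<open>For \<open>a = ln n\<close> the function is \<open>n powr (z - 1)\<close>, with
  derivative of order \<open>k\<close> at \<open>1/2\<close> equal to
  \<open>(ln n)^k / sqrt n\<close>.\<close>

lemma higher_deriv_exp_affine:
  "(deriv ^^ k) (\<lambda>z::complex. exp ((z - 1) * a)) = (\<lambda>z. a ^ k * exp ((z - 1) * a))"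
proof (induction k)
  case (Suc k)
  have "deriv (\<lambda>z. a ^ k * exp ((z - 1) * a)) z = a ^ Suc k * exp ((z - 1) * a)" for z
    by (rule DERIV_imp_deriv) (auto intro!: derivative_eq_intros)
  then show ?case using Suc by auto
qed simp

text \<open>The hypotheses \<open>val\<close> and \<open>der\<close> say that, on the coordinates
  below \<open>n\<close>, \<open>f\<close> agrees with the constant \<open>s\<close> at
  \<open>1/2\<close> up to order \<open>m\<close>. Unimodularity of \<open>s\<close> makes the
  pairing there equal to \<open>n\<close>.\<close>

lemma calderon_norm_lower_bound:
  fixes f :: "complex \<Rightarrow> linf" and s :: "nat \<Rightarrow> complex" and n m :: nat
  assumes f: "f \<in> calderon" and n: "n \<ge> 1" and s: "\<And>j. j < n \<Longrightarrow> cmod (s j) = 1"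
    and val: "\<And>j. j < n \<Longrightarrow> apply_bcontfun (f (1/2)) j = s j"
    and der: "\<And>j k. j < n \<Longrightarrow> 0 < k \<Longrightarrow> k \<le> m \<Longrightarrow> (deriv ^^ k) (\<lambda>z. apply_bcontfun (f z) j) (1/2) = 0"
  shows "sqrt n * ln n ^ m \<le> fact m * 2 ^ m * calderon_norm f"
proof -
  define L where "L = ln (real n)"
  have expL: "exp L = n" using n by (simp add: L_def)
  have L: "L \<ge> 0" using n by (simp add: L_def)
  define K where "K = calderon_norm f"
  define F where "F z = (\<Sum>j<n. cnj (s j) * apply_bcontfun (f z) j)" for z
  \<comment> \<open>The weight has modulus \<open>1 / n\<close> on the left edge, where
    \<open>F\<close> is at most \<open>n * K\<close>, and 1 on the right edge, where
    \<open>F\<close> is at most the l1 norm and so at most \<open>K\<close>.\<close>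
  define E where "E z = exp ((z - 1) * complex_of_real L)" for z
  have half: "(1/2::complex) \<in> strip" by (simp add: strip_def)
  have holf: "(\<lambda>z. apply_bcontfun (f z) j) holomorphic_on strip" for j
    using calderon_coord_holomorphic[OF f] by (simp add: coord_holomorphic_def)
  have holF: "F holomorphic_on strip"
    unfolding F_def by (intro holomorphic_intros holf)
  have holE: "E holomorphic_on strip"
    unfolding E_def by (intro holomorphic_intros)
  have contf: "continuous_on (closure strip) f" and bddf: "bounded (f ` closure strip)"
    and l1: "in_l1 (f (Complex 1 t))" for t
    using f by (auto simp: calderon_def)
  have cont: "continuous_on (closure strip) (\<lambda>z. E z * F z)"
    unfolding E_def F_def
    by (intro continuous_intros bounded_linear.continuous_on[OF bounded_linear_apply_bcontfun contf])
  have Fle: "cmod (F z) \<le> (\<Sum>j<n. cmod (apply_bcontfun (f z) j))" for z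
    unfolding F_def by (rule sum_norm_le) (simp add: norm_mult s)
  have Fle': "cmod (F z) \<le> n * norm (f z)" for z
    by (rule order_trans[OF Fle]) (use sum_bounded_above[of "{..<n}" "\<lambda>j. cmod (apply_bcontfun (f z) j)"] norm_bounded in auto)
  have cE: "cmod (E z) = exp ((Re z - 1) * L)" for z
    by (simp add: E_def)
  have bound: "cmod (E z * F z) \<le> K" if "z \<in> closure strip" for z
  proof (rule strip_maximum_principle[OF cont _ _ _ _ that])
    show "(\<lambda>z. E z * F z) holomorphic_on strip" by (intro holomorphic_intros holE holF)
    obtain B where B: "\<And>z. z \<in> closure strip \<Longrightarrow> norm (f z) \<le> B"
      using bddf unfolding bounded_iff by auto
    have "cmod (E z * F z) \<le> n * B" if z: "z \<in> closure strip" for z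
    proof -
      have "cmod (E z) \<le> 1" using z L by (simp add: cE closure_strip mult_nonpos_nonneg)
      moreover have "cmod (F z) \<le> n * B"
        by (rule order_trans[OF Fle']) (simp add: B[OF z] mult_left_mono)
      ultimately show ?thesis using mult_mono[of "cmod (E z)" 1 "cmod (F z)" "n * B"] by (simp add: norm_mult)
    qed
    then show "bounded ((\<lambda>z. E z * F z) ` closure strip)" unfolding bounded_iff by blast
  next
    fix t
    have "cmod (F (Complex 0 t)) \<le> n * K"
      by (rule order_trans[OF Fle']) (simp add: norm_le_calderon_norm[OF f] K_def mult_left_mono)
    then show "cmod (E (Complex 0 t) * F (Complex 0 t)) \<le> K"
      using n by (simp add: norm_mult cE exp_minus expL field_simps)
    have "cmod (F (Complex 1 t)) \<le> l1_norm (f (Complex 1 t))"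
      using l1[of t] unfolding l1_norm_def in_l1_def
      by (intro order_trans[OF Fle] sum_le_suminf) auto
    then show "cmod (E (Complex 1 t) * F (Complex 1 t)) \<le> K"
      using l1_norm_le_calderon_norm[OF f, of t] by (simp add: norm_mult cE K_def)
  qed
  have cb: "cball (1/2) (1/2) \<subseteq> closure strip"
  proof
    fix z :: complex assume "z \<in> cball (1/2) (1/2)"
    then have "\<bar>1/2 - Re z\<bar> \<le> 1/2"
      using abs_Re_le_cmod[of "1/2 - z"] by (simp add: dist_norm)
    then have "0 \<le> Re z" "Re z \<le> 1" by linarith+
    then show "z \<in> closure strip" by (simp add: closure_strip)
  qed
  have b: "ball (1/2) (1/2) \<subseteq> strip"
  proof
    fix z :: complex assume "z \<in> ball (1/2) (1/2)"
    then have "\<bar>1/2 - Re z\<bar> < 1/2"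
      using abs_Re_le_cmod[of "1/2 - z"] by (simp add: dist_norm)
    then have "0 < Re z" "Re z < 1" by linarith+
    then show "z \<in> strip" by (simp add: strip_def)
  qed
  \<comment> \<open>The disc about \<open>1/2\<close> of radius \<open>1/2\<close> is the largest
    one in the closed strip; its radius is the source of the factor \<open>2 ^ m\<close>.\<close>
  have "cmod ((deriv ^^ m) (\<lambda>z. E z * F z) (1/2)) \<le> fact m * K / (1/2) ^ m"
  proof (rule Cauchy_inequality)
    show "(\<lambda>z. E z * F z) holomorphic_on ball (1/2) (1/2)"
      using b by (intro holomorphic_intros holomorphic_on_subset[OF holE] holomorphic_on_subset[OF holF])
    show "continuous_on (cball (1/2) (1/2)) (\<lambda>z. E z * F z)"
      using cont cb by (rule continuous_on_subset)
    fix x :: complex assume "cmod (1/2 - x) = 1/2"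
    then have "x \<in> cball (1/2) (1/2)" by (simp add: dist_norm)
    then show "cmod (E x * F x) \<le> K" using bound cb by blast
  qed simp
  also have "(deriv ^^ m) (\<lambda>z. E z * F z) (1/2) = of_real (sqrt n * L ^ m)"
  proof -
    have derF: "(deriv ^^ k) F (1/2) = (if k = 0 then of_nat n else 0)" if "k \<le> m" for k
    proof -
      have "(deriv ^^ k) F (1/2) = (\<Sum>j<n. cnj (s j) * (deriv ^^ k) (\<lambda>z. apply_bcontfun (f z) j) (1/2))"
      proof -
        have "(deriv ^^ k) F (1/2) = (\<Sum>j<n. (deriv ^^ k) (\<lambda>z. cnj (s j) * apply_bcontfun (f z) j) (1/2))"
          unfolding F_def by (intro higher_deriv_sum[OF _ open_strip half] holomorphic_intros holf)
        then show ?thesis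
          by (simp add: higher_deriv_cmult[OF holf half open_strip])
      qed
      also have "\<dots> = (\<Sum>j<n. if k = 0 then 1 else 0)"
        using that s
        by (intro sum.cong) (auto simp: val der complex_norm_square[symmetric] mult.commute[of "cnj _"])
      finally show ?thesis by simp
    qed
    have "(deriv ^^ m) (\<lambda>z. E z * F z) (1/2) =
        (\<Sum>i = 0..m. of_nat (m choose i) * (deriv ^^ i) E (1/2) * (deriv ^^ (m - i)) F (1/2))"
      by (rule higher_deriv_mult[OF holE holF open_strip half])
    \<comment> \<open>In the Leibniz sum all derivatives of \<open>F\<close> of order 1 to
      \<open>m\<close> vanish at \<open>1/2\<close>, so only the term with all derivatives on
      \<open>E\<close> remains.\<close>
    also have "\<dots> = (\<Sum>i\<in>{m}. of_nat (m choose i) * (deriv ^^ i) E (1/2) * (deriv ^^ (m - i)) F (1/2))"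
      by (rule sum.mono_neutral_right) (auto simp: derF)
    also have "\<dots> = of_real L ^ m * E (1/2) * of_nat n"
      using higher_deriv_exp_affine[of m "of_real L"] derF[of 0] by (simp add: E_def[abs_def])
    also have "E (1/2) = of_real (exp (- L / 2))"
      by (simp add: E_def exp_of_real[symmetric])
    also have "of_real L ^ m * of_real (exp (- L / 2)) * (of_nat n :: complex)
        = of_real (L ^ m * (exp (- L / 2) * n))"
      by simp
    also have "exp (- L / 2) * n = sqrt n"
    proof (rule real_sqrt_unique[symmetric])
      have "exp (- L / 2) * real n = exp (L / 2)"
        unfolding expL[symmetric] exp_add[symmetric] by simp
      then show "(exp (- L / 2) * real n)\<^sup>2 = real n"
        by (simp add: expL flip: exp_double)
    qed simp
    finally show ?thesis by (simp add: mult_ac)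
  qed
  finally have "sqrt n * L ^ m \<le> fact m * K / (1/2) ^ m"
    using L by (simp add: norm_mult norm_power)
  then show ?thesis by (simp add: L_def K_def power_divide mult_ac)
qed

section \<open>The test vectors and the comparison of constants\<close>

lemma unit_sequence:
  obtains e :: "nat \<Rightarrow> linf" where "\<And>i j. apply_bcontfun (e i) j = (if j = i then 1 else 0)"
    "\<And>i. in_l1 (e i)" "\<And>i. calderon_norm (\<lambda>_. e i) \<le> 1"
proof -
  define e :: "nat \<Rightarrow> linf" where "e i = Bcontfun (\<lambda>j. if j = i then 1 else 0)" for i
  have e: "apply_bcontfun (e i) j = (if j = i then 1 else 0)" for i j
  proof -
    have "(\<lambda>j::nat. if j = i then 1 else 0 :: complex) \<in> bcontfun"
      by (rule bcontfun_normI[where b = 1]) auto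
    then show ?thesis by (simp add: e_def Bcontfun_inverse)
  qed
  have sums: "(\<lambda>j. norm (apply_bcontfun (e i) j)) sums 1" for i
    using sums_single[of i "\<lambda>_. 1::real"] by (simp add: e if_distrib cong: if_cong)
  have "norm (e i) \<le> 1" for i
    by (rule norm_bound) (simp add: e)
  moreover have "l1_norm (e i) = 1" for i
    using sums_unique[OF sums] by (simp add: l1_norm_def)
  ultimately have "calderon_norm (\<lambda>_. e i) \<le> 1" for i
    by (intro calderon_norm_least) auto
  moreover have "in_l1 (e i)" for i
    using sums_summable[OF sums] by (simp add: in_l1_def)
  ultimately show thesis using e that by blast
qed

lemma apply_bcontfun_sum_fun:
  "apply_bcontfun ((\<Sum>i\<in>A. x i) k) j = (\<Sum>i\<in>A. apply_bcontfun (x i k) j)"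
  for x :: "'i \<Rightarrow> nat \<Rightarrow> linf"
  by (induction A rule: infinite_finite_induct) auto

theorem lemma4p4:
  fixes m :: nat
  shows "\<exists>c::real. c > 0 \<and>
    (\<forall>n::nat. n \<ge> 1 \<longrightarrow>
      c * (log 2 (real n)) ^ m \<le> type2_const (Z_space (m + 1)) (Z_norm (m + 1)) n)"
proof (intro exI conjI allI impI)
  \<comment> \<open>The denominator comes from Cauchy's inequality, and \<open>ln 2 ^ m\<close>
    converts \<open>log 2\<close> to \<open>ln\<close>.\<close>
  show "ln 2 ^ m / (fact m * 2 ^ m) > (0::real)" by simp
  fix n :: nat assume n: "n \<ge> 1"
  define c where "c = ln (real n) ^ m / (fact m * 2 ^ m)"
  have c: "c \<ge> 0" using n by (simp add: c_def)
  obtain e :: "nat \<Rightarrow> linf" where e: "\<And>i j. apply_bcontfun (e i) j = (if j = i then 1 else 0)"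
    and l1: "\<And>i. in_l1 (e i)" and le1: "\<And>i. calderon_norm (\<lambda>_. e i) \<le> 1"
    using unit_sequence by blast
  \<comment> \<open>Tuples list the highest order first, so index \<open>m\<close> holds the value
    at \<open>1/2\<close> and \<open>x i\<close> is the jet of the constant
    \<open>e i\<close>.\<close>
  define x where "x i = (\<lambda>k. if k = m then e i else 0)" for i
  have jx: "jet (m + 1) (\<lambda>_. e i) = x i" for i
    using jet_const[OF l1] by (simp add: x_def)
  have xZ: "x i \<in> Z_space (m + 1)" for i
    unfolding Z_space_def using jx[of i] calderon_const[OF l1] by (metis image_eqI)
  have Nx: "Z_norm (m + 1) (x i) \<le> 1" for i
    using Z_norm_le[OF calderon_const[OF l1], of "m + 1" i] le1[of i] jx[of i] by simp
  \<comment> \<open>The bound holds for every choice of signs, hence passes to the average of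
    squares.\<close>
  have signed: "sqrt n * c \<le> Z_norm (m + 1) (\<Sum>i<n. if i \<in> P then x i else - x i)" (is "_ \<le> Z_norm _ ?y") for P
  proof (rule Z_norm_greatest)
    show "?y \<in> Z_space (m + 1)" using xZ by (intro Z_signed_sum)
    fix f assume f: "f \<in> calderon" and jf: "jet (m + 1) f = ?y"
    define s :: "nat \<Rightarrow> complex" where "s j = (if j \<in> P then 1 else -1)" for j
    have y: "apply_bcontfun (?y k) j = (if k = m then s j else 0)" if "j < n" for k j
    proof -
      have "apply_bcontfun (?y k) j = (\<Sum>i<n. if i = j then if k = m then s j else 0 else 0)"
        unfolding apply_bcontfun_sum_fun by (rule sum.cong) (auto simp: x_def e s_def)
      then show ?thesis using that by simp
    qed
    have "sqrt n * ln n ^ m \<le> fact m * 2 ^ m * calderon_norm f"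
    proof (rule calderon_norm_lower_bound[OF f n])
      show "cmod (s j) = 1" for j by (simp add: s_def)
      show "apply_bcontfun (f (1/2)) j = s j" if "j < n" for j
        using y[OF that, of m] jet_coord[OF f, of "m + 1" m j, unfolded jf] by simp
      show "(deriv ^^ k) (\<lambda>z. apply_bcontfun (f z) j) (1/2) = 0" if "j < n" "0 < k" "k \<le> m" for j k
      proof -
        \<comment> \<open>The Taylor coefficient of order \<open>k\<close> sits at index
          \<open>m - k\<close>, which differs from \<open>m\<close> as \<open>k\<close> is positive;
          there the signed sum has entry 0.\<close>
        have "m + 1 - 1 - (m - k) = k" "m - k \<noteq> m" "m - k < m + 1" using that by auto
        then show ?thesis
          using y[OF that(1), of "m - k"] jet_coord[OF f, of "m + 1" "m - k" j, unfolded jf]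
          by (simp only: if_True if_False) (simp split: if_splits)
      qed
    qed
    then show "sqrt n * c \<le> calderon_norm f" by (simp add: c_def divide_simps mult_ac)
  qed
  have "c \<le> type2_const (Z_space (m + 1)) (Z_norm (m + 1)) n"
    unfolding type2_const_def
  proof (rule cInf_greatest)
    show "{a. 0 \<le> a \<and> (\<forall>x. (\<forall>i<n. x i \<in> Z_space (m + 1)) \<longrightarrow>
        (\<Sum>P\<in>Pow {..<n}. (Z_norm (m + 1) (\<Sum>i<n. if i \<in> P then x i else - x i))\<^sup>2) / 2 ^ n
         \<le> a\<^sup>2 * (\<Sum>i<n. (Z_norm (m + 1) (x i))\<^sup>2))} \<noteq> {}"
      using Z_type2_bound[of n _ "m + 1"] by (intro ex_in_conv[THEN iffD1] exI[of _ "sqrt n"]) auto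
    fix a assume "a \<in> {a. 0 \<le> a \<and> (\<forall>x. (\<forall>i<n. x i \<in> Z_space (m + 1)) \<longrightarrow>
        (\<Sum>P\<in>Pow {..<n}. (Z_norm (m + 1) (\<Sum>i<n. if i \<in> P then x i else - x i))\<^sup>2) / 2 ^ n
         \<le> a\<^sup>2 * (\<Sum>i<n. (Z_norm (m + 1) (x i))\<^sup>2))}"
    then have a: "0 \<le> a" and
      ax: "(\<Sum>P\<in>Pow {..<n}. (Z_norm (m + 1) (\<Sum>i<n. if i \<in> P then x i else - x i))\<^sup>2) / 2 ^ n
         \<le> a\<^sup>2 * (\<Sum>i<n. (Z_norm (m + 1) (x i))\<^sup>2)"
      using xZ by auto
    have "of_nat (card (Pow {..<n})) * (sqrt n * c)\<^sup>2
      \<le> (\<Sum>P\<in>Pow {..<n}. (Z_norm (m + 1) (\<Sum>i<n. if i \<in> P then x i else - x i))\<^sup>2)"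
      using signed c by (intro sum_bounded_below power_mono) auto
    then have "n * c\<^sup>2 \<le> (\<Sum>P\<in>Pow {..<n}. (Z_norm (m + 1) (\<Sum>i<n. if i \<in> P then x i else - x i))\<^sup>2) / 2 ^ n"
      by (simp add: card_Pow power_mult_distrib divide_simps mult_ac)
    also note ax
    \<comment> \<open>The test vectors have norm at most 1, so the right side is at most
      \<open>n * a^2\<close>; this \<open>n\<close> cancels the one from
      \<open>(sqrt n * c)^2\<close>.\<close>
    also have "a\<^sup>2 * (\<Sum>i<n. (Z_norm (m + 1) (x i))\<^sup>2) \<le> a\<^sup>2 * (\<Sum>i<n. 1)"
      using Nx Z_norm_nonneg[OF xZ] by (intro mult_left_mono sum_mono power_le_one) auto
    finally have "c\<^sup>2 \<le> a\<^sup>2" using n by simp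
    then show "c \<le> a" using a by (rule power2_le_imp_le)
  qed
  then show "ln 2 ^ m / (fact m * 2 ^ m) * (log 2 (real n)) ^ m
      \<le> type2_const (Z_space (m + 1)) (Z_norm (m + 1)) n"
    by (simp add: c_def log_def power_divide)
qed

end
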